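(* Let $D$ be a bounded convex domain in $\mathbb C^n$, let $f:\mathbb D\to D$ be a complex geodesic in $D$ and let $G:D\to\mathbb D$ be its left inverse. Assume that $f$ extends holomorphically through $\lambda_0\in\overline{\mathbb D}$ and that $G$ extends holomorphically through $f(\lambda_0)\in\partial D$. Then the corresponding Lempert left inverse $H$ to $f$ extends holomorphically through $f(\lambda_0)$.
   Context: $\mathbb D$ is the open unit disc in $\mathbb C$. For $w,z\in\mathbb C^n$, $w\bullet z:=\sum_{j=1}^n w_jz_j$. For a holomorphic function $G$ on $D$, $G'(z)=(\partial G/\partial z_1(z),\ldots,\partial G/\partial z_n(z))$. A holomorphic map $f:\mathbb D\to D$ is a complex geodesic if there is a holomorphic function $G:D\to\mathbb D$ with $G(f(\lambda))=\lambda$ for all $\lambda\in\mathbb D$; any such $G$ is called a left inverse to $f$. A left inverse $G$ is called a Lempert left inverse if for every $\lambda\in\mathbb D$ the fiber $G^{-1}(\lambda)$ is the intersection of $D$ with a complex affine hyperplane of $\mathbb C^n$. The Lempert left inverse $H$ corresponding to a left inverse $G$ of $f$ (in a bounded convex domain $D$) is defined as follows: for each $z\in D$, $H(z)$ is the unique $\lambda\in\mathbb D$ with $(z-f(\lambda))\bullet G'(f(\lambda))=0$. It is a fact that this $\lambda$ exists and is unique, and that $H$ is a (holomorphic) Lempert left inverse to $f$ with $H'(f(\lambda))=G'(f(\lambda))$ for $\lambda\in\mathbb D$. A holomorphic map on an open set $\Omega$ extends holomorphically through a point $a\in\overline\Omega$ if there are an open neighborhood $U$ of $a$ and a holomorphic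 map on $U$ that agrees with the given one on $U\cap\Omega$; $f(\lambda_0)$ denotes the value of the extension of $f$ at $\lambda_0$. *)

theory Defs
  imports "HOL-Complex_Analysis.Complex_Analysis"
begin

definition cdot :: "complex ^ 'n \<Rightarrow> complex ^ 'n \<Rightarrow> complex" where
  "cdot w z = (\<Sum>j\<in>UNIV. w $ j * z $ j)"

definition disc :: "complex set" where
  "disc = ball 0 1"

definition holomorphic_curve_on :: "(complex \<Rightarrow> complex ^ 'n) \<Rightarrow> complex set \<Rightarrow> bool" where
  "holomorphic_curve_on f S \<longleftrightarrow> (\<forall>j. (\<lambda>z. f z $ j) holomorphic_on S)"

text \<open>
  Holomorphy in several variables: the derivative in \<open>has_derivative\<close> is only real-linear, so
  compatibility with complex scalars is demanded separately. Used for open \<open>S\<close> only.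
\<close>
definition holomorphic_fun_on :: "(complex ^ 'n \<Rightarrow> complex) \<Rightarrow> (complex ^ 'n) set \<Rightarrow> bool" where
  "holomorphic_fun_on G S \<longleftrightarrow>
     (\<forall>z\<in>S. \<exists>L. (G has_derivative L) (at z within S) \<and> (\<forall>c v. L (c *s v) = c * L v))"

text \<open>The vector of complex partial derivatives.\<close>
definition cgrad :: "(complex ^ 'n \<Rightarrow> complex) \<Rightarrow> complex ^ 'n \<Rightarrow> complex ^ 'n" where
  "cgrad G z = (\<chi> j. deriv (\<lambda>t. G (z + t *s axis j 1)) 0)"

definition left_inverse ::
    "(complex ^ 'n) set \<Rightarrow> (complex \<Rightarrow> complex ^ 'n) \<Rightarrow> (complex ^ 'n \<Rightarrow> complex) \<Rightarrow> bool" where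
  "left_inverse D f G \<longleftrightarrow>
     holomorphic_fun_on G D \<and> G ` D \<subseteq> disc \<and> (\<forall>l\<in>disc. G (f l) = l)"

definition complex_geodesic :: "(complex ^ 'n) set \<Rightarrow> (complex \<Rightarrow> complex ^ 'n) \<Rightarrow> bool" where
  "complex_geodesic D f \<longleftrightarrow>
     holomorphic_curve_on f disc \<and> f ` disc \<subseteq> D \<and> (\<exists>G. left_inverse D f G)"

text \<open>
  The Lempert left inverse corresponding to a left inverse \<open>G\<close> of \<open>f\<close>; it is meaningful on the
  domain \<open>D\<close> of \<open>G\<close>, where the description is satisfied by exactly one point if \<open>D\<close> is bounded
  and convex. Outside \<open>D\<close> the value is irrelevant.
\<close>
definition lempert_left_inverse ::
    "(complex \<Rightarrow> complex ^ 'n) \<Rightarrow> (complex ^ 'n \<Rightarrow> complex) \<Rightarrow> complex ^ 'n \<Rightarrow> complex" where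
  "lempert_left_inverse f G z = (THE l. l \<in> disc \<and> cdot (z - f l) (cgrad G (f l)) = 0)"

text \<open>
  The extension \<open>F\<close> of a curve is exposed as an argument, so that its value \<open>F a\<close> can be referred
  to; for \<open>a\<close> in the closure of \<open>S\<close> this value does not depend on the choice of \<open>U\<close> and \<open>F\<close>.
\<close>
definition curve_extension_through ::
    "complex set \<Rightarrow> (complex \<Rightarrow> complex ^ 'n) \<Rightarrow> complex
      \<Rightarrow> complex set \<Rightarrow> (complex \<Rightarrow> complex ^ 'n) \<Rightarrow> bool" where
  "curve_extension_through S f a U F \<longleftrightarrow>
     open U \<and> a \<in> U \<and> holomorphic_curve_on F U \<and> (\<forall>z\<in>U \<inter> S. F z = f z)"

definition fun_extends_through ::
    "(complex ^ 'n) set \<Rightarrow> (complex ^ 'n \<Rightarrow> complex) \<Rightarrow> complex ^ 'n \<Rightarrow> bool" where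
  "fun_extends_through S G a \<longleftrightarrow>
     (\<exists>U E. open U \<and> a \<in> U \<and> holomorphic_fun_on E U \<and> (\<forall>z\<in>U \<inter> S. E z = G z))"

end

theory Submission imports Defs begin

text \<open>
  Let \<open>E\<close> be the extension of \<open>G\<close> near \<open>F l0\<close>, put \<open>w l = cgrad E (F l)\<close>, and consider
  \<open>P z l = cdot (z - F l) (w l)\<close> for \<open>z\<close> near \<open>F l0\<close> and \<open>l\<close> near \<open>l0\<close>. The function \<open>P\<close> vanishes at
  \<open>(F l0, l0)\<close>. Differentiating \<open>E (F l) = l\<close> gives \<open>cdot (curve_deriv F l) (w l) = 1\<close> in the disc
  near \<open>l0\<close>, and by continuity on its closure near \<open>l0\<close>, so the \<open>l\<close>-derivative of \<open>P\<close> at \<open>(F l0, l0)\<close> is \<open>-1\<close>. By the implicit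
  function theorem (\<open>implicit_hyperplane_parameter\<close>) the equation \<open>P z l = 0\<close> has, near \<open>l0\<close>, exactly
  one solution \<open>l = h z\<close>, and \<open>h\<close> is holomorphic near \<open>F l0\<close>. It remains to see that \<open>h\<close> is the
  Lempert left inverse at the points of \<open>D\<close>: that \<open>h z\<close> lies in the disc, and that the defining
  equation of the Lempert left inverse has no other solution there.

  For the first point, \<open>h z\<close> never lies on the unit circle when \<open>z \<in> D\<close>. Indeed \<open>E\<close> maps \<open>D\<close> near
  \<open>x = F (h z)\<close> into the disc, and \<open>E x = h z\<close> would have modulus \<open>1\<close>. So on every segment from \<open>x\<close>
  to a point \<open>y\<close> of \<open>D\<close> the modulus of \<open>E\<close> starts at its maximum, which implies that the real
  part of \<open>cnj (E x) * cdot (y - x) (cgrad E x)\<close> is nonpositive. Letting \<open>y\<close> vary over a small ball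
  around \<open>z\<close>, where \<open>cdot (z - x) (cgrad E x) = 0\<close>, forces \<open>cgrad E x = 0\<close>
  (\<open>boundary_gradient_zero\<close>), contrary to \<open>cdot (curve_deriv F l) (w l) = 1\<close>. The part of \<open>D\<close> near
  \<open>F l0\<close> is convex, hence connected, and it contains points \<open>f l\<close>, for which \<open>h (f l) = l\<close> is in the
  disc. So \<open>h\<close> takes values in the disc on all of it.

  For the second point, pushing \<open>f\<close> towards another holomorphic curve \<open>g\<close> in \<open>D\<close> gives the
  holomorphic self-maps \<open>l \<mapsto> G (f l + t * (g l - f l))\<close> of the disc, starting from the identity at
  \<open>t = 0\<close>. By Schwarz--Pick they contract the hyperbolic distance, and the derivative at \<open>t = 0\<close> of
  this statement is \<open>push_towards_curve_contracts\<close>. If \<open>a \<noteq> b\<close> both solved the equation for \<open>z\<close>, one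
  could take for \<open>g\<close> a small perturbation of the constant curve \<open>z\<close> that still has \<open>a\<close> as a zero;
  as the direction of the perturbation at \<open>b\<close> is arbitrary, \<open>cgrad G (f b) = 0\<close> follows, again a
  contradiction (\<open>gradient_zero_unique\<close>).
\<close>

section \<open>Complex gradients and derivatives along curves\<close>

lemma cdot_commute: "cdot v w = cdot w v"
  by (simp add: cdot_def mult.commute)

lemma cdot_scale_left: "cdot (c *s v) w = c * cdot v w"
  by (simp add: cdot_def sum_distrib_left mult.assoc)

lemma cdot_axis_left: "cdot (axis j 1) w = w $ j"
  by (simp add: cdot_def axis_def if_distrib if_distribR cong: if_cong)

lemma bounded_bilinear_cdot: "bounded_bilinear (cdot :: complex ^ 'n \<Rightarrow> _)"
proof
  show "\<exists>K. \<forall>a b :: complex ^ 'n. norm (cdot a b) \<le> norm a * norm b * K"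
  proof (intro exI allI)
    fix a b :: "complex ^ 'n"
    have "norm (cdot a b) \<le> (\<Sum>j\<in>(UNIV :: 'n set). norm a * norm b)"
      unfolding cdot_def
      by (rule sum_norm_le) (simp add: norm_mult mult_mono Finite_Cartesian_Product.norm_nth_le)
    then show "norm (cdot a b) \<le> norm a * norm b * of_nat CARD('n)"
      by (simp add: mult.commute)
  qed
qed (simp_all add: cdot_def sum.distrib algebra_simps scaleR_sum_right)

interpretation cdot: bounded_bilinear "cdot :: complex ^ 'n \<Rightarrow> _"
  by (rule bounded_bilinear_cdot)

lemma bounded_linear_scale_vector: "bounded_linear (\<lambda>t. t *s (v :: complex ^ 'n))"
  unfolding linear_conv_bounded_linear [symmetric]
  by (rule linearI) (simp_all add: vec_eq_iff algebra_simps)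

lemma norm_scale_axis: "norm (c *s (axis j 1 :: complex ^ 'n)) = norm c"
proof -
  have "c *s (axis j 1 :: complex ^ 'n) = axis j c"
    by (simp add: vec_eq_iff axis_def)
  then show ?thesis
    by (simp add: norm_vec_def L2_set_def axis_def if_distrib [of norm]
          if_distrib [of "\<lambda>x. x\<^sup>2"] cong: if_cong)
qed

definition curve_deriv :: "(complex \<Rightarrow> complex ^ 'n) \<Rightarrow> complex \<Rightarrow> complex ^ 'n" where
  "curve_deriv f l = (\<chi> j. deriv (\<lambda>z. f z $ j) l)"

text \<open>A complex-linear functional is determined by its values on the coordinate vectors.\<close>
lemma holomorphic_fun_on_has_derivative:
  assumes "holomorphic_fun_on G S" "open S" "x \<in> S"
  shows "(G has_derivative (\<lambda>v. cdot v (cgrad G x))) (at x)"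
proof -
  from assms obtain L where L: "(G has_derivative L) (at x)"
    and cl: "\<And>c v. L (c *s v) = c * L v"
    unfolding holomorphic_fun_on_def by (metis at_within_open)
  interpret bounded_linear L using L by (rule has_derivative_bounded_linear)
  have ax: "L (axis j 1) = cgrad G x $ j" for j
  proof -
    have "((\<lambda>t. x + t *s axis j 1) has_derivative (\<lambda>t. t *s axis j 1)) (at 0)"
      by (rule derivative_eq_intros bounded_linear.has_derivative [OF bounded_linear_scale_vector]
            refl | simp)+
    then have "((\<lambda>t. G (x + t *s axis j 1)) has_derivative (\<lambda>t. L (t *s axis j 1))) (at 0)"
      by (rule has_derivative_compose) (simp add: L)
    then have "((\<lambda>t. G (x + t *s axis j 1)) has_field_derivative L (axis j 1)) (at 0)"
      by (simp add: has_field_derivative_def cl mult.commute[of _ "L (axis j 1)"])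
    then show ?thesis
      by (simp add: cgrad_def DERIV_imp_deriv)
  qed
  have "L v = cdot v (cgrad G x)" for v
  proof -
    have "v = (\<Sum>j\<in>UNIV. v $ j *s axis j 1)"
      by (simp add: basis_expansion)
    then have "L v = (\<Sum>j\<in>UNIV. L (v $ j *s axis j 1))"
      by (metis sum)
    then show ?thesis
      by (simp add: cl ax cdot_def)
  qed
  then have "L = (\<lambda>v. cdot v (cgrad G x))"
    by (rule ext)
  with L show ?thesis
    by simp
qed

lemma has_derivative_vec_componentwise:
  fixes f :: "'a::real_normed_vector \<Rightarrow> ('b::real_normed_vector) ^ 'n"
  assumes "\<And>j. ((\<lambda>x. f x $ j) has_derivative (\<lambda>h. f' h $ j)) (at a)"
  shows "(f has_derivative f') (at a)"
proof -
  obtain K where K: "\<And>j h. norm (f' h $ j) \<le> norm h * K j"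
    using bounded_linear.bounded [OF has_derivative_bounded_linear [OF assms]] by metis
  have "bounded_linear f'"
  proof (rule bounded_linear_intro)
    fix x y r
    note lin = bounded_linear.linear [OF has_derivative_bounded_linear [OF assms]]
    show "f' (x + y) = f' x + f' y" "f' (r *\<^sub>R x) = r *\<^sub>R f' x"
      using linear_add [OF lin] linear_scale [OF lin] by (simp_all add: vec_eq_iff)
    show "norm (f' x) \<le> norm x * (\<Sum>j\<in>UNIV. K j)"
    proof -
      have "norm (f' x) \<le> (\<Sum>j\<in>UNIV. norm (f' x $ j))"
        unfolding norm_vec_def by (rule L2_set_le_sum) simp
      also have "\<dots> \<le> (\<Sum>j\<in>UNIV. norm x * K j)"
        by (intro sum_mono K)
      finally show ?thesis by (simp add: sum_distrib_left)
    qed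
  qed
  moreover have "((\<lambda>y. ((f y - f a) - f' (y - a)) /\<^sub>R norm (y - a)) \<longlongrightarrow> 0) (at a)"
    by (rule vec_tendstoI) (use assms in \<open>simp add: has_derivative_at_within\<close>)
  ultimately show ?thesis
    by (simp add: has_derivative_at_within)
qed

lemma holomorphic_curve_on_has_derivative:
  assumes "holomorphic_curve_on f S" "open S" "l \<in> S"
  shows "(f has_derivative (\<lambda>t. t *s curve_deriv f l)) (at l)"
proof (rule has_derivative_vec_componentwise)
  fix j
  have "((\<lambda>z. f z $ j) has_field_derivative curve_deriv f l $ j) (at l)"
    using assms holomorphic_derivI [of "\<lambda>z. f z $ j" S l UNIV]
    by (simp add: holomorphic_curve_on_def curve_deriv_def)
  then show "((\<lambda>x. f x $ j) has_derivative (\<lambda>h. (h *s curve_deriv f l) $ j)) (at l)"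
    by (simp add: has_field_derivative_def mult_commute_abs)
qed

lemma holomorphic_fun_on_curve_derivative:
  assumes "holomorphic_fun_on G S" "open S" "f l \<in> S"
    and "(f has_derivative (\<lambda>t. t *s v)) (at l)"
  shows "((\<lambda>t. G (f t)) has_field_derivative cdot v (cgrad G (f l))) (at l)"
proof -
  have "((\<lambda>t. G (f t)) has_derivative (\<lambda>t. cdot (t *s v) (cgrad G (f l)))) (at l)"
    by (rule has_derivative_compose [OF assms(4) holomorphic_fun_on_has_derivative]) fact+
  then show ?thesis
    by (simp add: has_field_derivative_def cdot_scale_left mult_commute_abs)
qed

lemma holomorphic_fun_on_segment_derivative:
  assumes "holomorphic_fun_on G S" "open S" "x \<in> S"
  shows "((\<lambda>t::real. G (x + t *\<^sub>R v)) has_vector_derivative cdot v (cgrad G x)) (at 0)"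
proof -
  have "((\<lambda>t::real. x + t *\<^sub>R v) has_derivative (\<lambda>t. t *\<^sub>R v)) (at 0)"
    by (auto intro!: derivative_eq_intros)
  then have "((\<lambda>t::real. G (x + t *\<^sub>R v)) has_derivative (\<lambda>t. cdot (t *\<^sub>R v) (cgrad G x))) (at 0)"
    by (rule has_derivative_compose) (simp add: holomorphic_fun_on_has_derivative [OF assms])
  then show ?thesis
    by (simp add: has_vector_derivative_def cdot.scaleR_left)
qed

lemma holomorphic_on_fun_curve:
  assumes "holomorphic_fun_on G S" "open S" "holomorphic_curve_on f T" "open T" "f ` T \<subseteq> S"
  shows "(\<lambda>t. G (f t)) holomorphic_on T"
proof -
  have "((\<lambda>t. G (f t)) has_field_derivative cdot (curve_deriv f l) (cgrad G (f l))) (at l)"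
    if "l \<in> T" for l
    using assms that
    by (intro holomorphic_fun_on_curve_derivative [of G S]
        holomorphic_curve_on_has_derivative [of f T]) auto
  then show ?thesis
    using assms(4) by (auto simp: holomorphic_on_open)
qed

text \<open>The chain rule applied to \<open>G (f t) = t\<close>. In particular the gradient does not vanish on the curve.\<close>
lemma gradient_pairing_of_section:
  assumes "holomorphic_fun_on G S" "open S" "f l \<in> S"
    and "holomorphic_curve_on f T" "open T" "l \<in> T"
    and "open W" "l \<in> W" "\<And>t. t \<in> W \<Longrightarrow> G (f t) = t"
  shows "cdot (curve_deriv f l) (cgrad G (f l)) = 1"
proof -
  have "((\<lambda>t. G (f t)) has_field_derivative cdot (curve_deriv f l) (cgrad G (f l))) (at l)"
    using assms by (intro holomorphic_fun_on_curve_derivative [of G S]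
        holomorphic_curve_on_has_derivative [of f T]) auto
  moreover have "((\<lambda>t. G (f t)) has_field_derivative 1) (at l)"
    by (rule has_field_derivative_transform_within_open [of "\<lambda>t. t" _ _ W]) (use assms in auto)
  ultimately show ?thesis
    by (rule DERIV_unique)
qed

section \<open>Maps whose modulus does not increase\<close>

text \<open>The derivative of \<open>t \<mapsto> (norm (p t))\<^sup>2\<close> at \<open>0\<close> is twice the inner product in question.\<close>
lemma inner_derivative_nonpos_of_norm_le:
  fixes p :: "real \<Rightarrow> 'a::real_inner"
  assumes "(p has_vector_derivative d) (at 0)"
    and "\<forall>\<^sub>F t in at_right 0. norm (p t) \<le> norm (p 0)"
  shows "inner (p 0) d \<le> 0"
proof (rule ccontr)
  assume "\<not> ?thesis"
  then have pos: "0 < inner (p 0) d + inner d (p 0)"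
    by (simp add: inner_commute)
  have "((\<lambda>t. inner (p t) (p t)) has_derivative (\<lambda>t. inner (p 0) (t *\<^sub>R d) + inner (t *\<^sub>R d) (p 0))) (at 0)"
    using assms(1) unfolding has_vector_derivative_def
    by (intro has_derivative_inner)
  then have "((\<lambda>t. inner (p t) (p t)) has_real_derivative inner (p 0) d + inner d (p 0)) (at 0)"
    by (rule has_derivative_imp_has_field_derivative) (simp add: algebra_simps)
  from DERIV_pos_inc_right [OF this pos] obtain e where e: "e > 0"
    "\<And>h. 0 < h \<Longrightarrow> h < e \<Longrightarrow> inner (p 0) (p 0) < inner (p h) (p h)"
    by auto
  have "\<forall>\<^sub>F t in at_right 0. t < e"
    using e(1) by (auto simp: eventually_at_right_field)
  with assms(2) have "\<forall>\<^sub>F t in at_right 0. norm (p t) \<le> norm (p 0) \<and> t < e \<and> 0 < t"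
    by (intro eventually_conj) (auto simp: eventually_at_right_less)
  then obtain t where "norm (p t) \<le> norm (p 0)" "t < e" "0 < t"
    using eventually_happens' [OF trivial_limit_at_right_real] by blast
  with e(2) [of t] show False
    by (simp add: dot_square_norm power_mono leD)
qed

text \<open>
  This turns a one-sided inequality into an equation: multiplication by all small complex \<open>c\<close> turns
  \<open>b\<close> into every direction, in particular into that of \<open>p\<close>.
\<close>
lemma zero_if_inner_small_multiples_nonpos:
  fixes p b :: complex
  assumes "p \<noteq> 0" "e > 0" "\<And>c. norm c < e \<Longrightarrow> inner p (c * b) \<le> 0"
  shows "b = 0"
proof (rule ccontr)
  assume "b \<noteq> 0"
  define d where "d = e / (2 * norm (p * b))"
  have d: "d > 0" using assms \<open>b \<noteq> 0\<close> by (simp add: d_def)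
  have "norm (of_real d * (p * cnj b)) = e / 2"
    using assms \<open>b \<noteq> 0\<close> d by (simp add: norm_mult) (simp add: d_def norm_mult)
  then have "inner p (of_real d * (p * cnj b) * b) \<le> 0"
    using assms by simp
  also have "of_real d * (p * cnj b) * b = (d * (norm b)\<^sup>2) *\<^sub>R p"
    by (simp add: scaleR_conv_of_real complex_norm_square algebra_simps del: of_real_power)
  finally show False
    using d assms(1) \<open>b \<noteq> 0\<close> by (simp add: mult_le_0_iff dot_square_norm)
qed

section \<open>Uniqueness of the Lempert parameter\<close>

text \<open>Moving \<open>a\<close> and \<open>k a\<close> to the origin by Moebius transformations reduces this to the Schwarz lemma.\<close>
lemma Schwarz_Pick:
  assumes "k holomorphic_on ball 0 1" "k ` ball 0 1 \<subseteq> ball 0 1" "norm a < 1" "norm b < 1"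
  shows "norm (Moebius_function 0 (k a) (k b)) \<le> norm (Moebius_function 0 a b)"
proof -
  define g where "g = (\<lambda>z. Moebius_function 0 (k a) (k (Moebius_function 0 (- a) z)))"
  have ka: "norm (k a) < 1"
    using assms by force
  have M: "norm (Moebius_function 0 (- a) z) < 1" if "norm z < 1" for z
    using that assms by (simp add: Moebius_function_norm_lt_1)
  have "(k \<circ> Moebius_function 0 (- a)) holomorphic_on ball 0 1"
    by (rule holomorphic_on_compose_gen [where t = "ball 0 1"])
      (use assms M in \<open>auto intro: Moebius_function_holomorphic\<close>)
  then have "(Moebius_function 0 (k a) \<circ> (k \<circ> Moebius_function 0 (- a))) holomorphic_on ball 0 1"
    by (rule holomorphic_on_compose_gen [where t = "ball 0 1"])
      (use assms ka M in \<open>auto intro: Moebius_function_holomorphic\<close>)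
  then have hol: "g holomorphic_on ball 0 1"
    by (simp add: g_def o_def)
  have "g 0 = 0"
    by (simp add: g_def Moebius_function_of_zero Moebius_function_eq_zero)
  have lt: "norm (g z) < 1" if "norm z < 1" for z
    unfolding g_def using assms(2) M [OF that]
    by (intro Moebius_function_norm_lt_1 [OF ka]) (auto simp: image_subset_iff)
  have "norm (g (Moebius_function 0 a b)) \<le> norm (Moebius_function 0 a b)"
    by (rule Schwarz_Lemma(1) [OF hol \<open>g 0 = 0\<close> lt])
      (use assms in \<open>auto simp: Moebius_function_norm_lt_1\<close>)
  then show ?thesis
    using assms by (simp add: g_def Moebius_function_compose)
qed

lemma holomorphic_curve_on_add_scaled:
  assumes "holomorphic_curve_on f S" "c holomorphic_on S"
  shows "holomorphic_curve_on (\<lambda>l. f l + c l *s v) S"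
  using assms unfolding holomorphic_curve_on_def by (auto intro!: holomorphic_intros)

lemma convex_segment_point:
  fixes x y :: "'a::real_vector"
  assumes "convex D" "x \<in> D" "y \<in> D" "0 \<le> t" "t \<le> 1"
  shows "x + t *\<^sub>R (y - x) \<in> D"
  using convexD_alt [OF assms] by (simp add: algebra_simps)

text \<open>
  The vector field \<open>X l = cdot (g l - f l) (cgrad G (f l))\<close> is the initial velocity of the self-maps
  \<open>k t l = G (f l + t * (g l - f l))\<close> of the disc. If \<open>X\<close> vanishes at \<open>a\<close>, then to first order \<open>a\<close> stays
  fixed, so contraction of the hyperbolic distance means that the image of \<open>b\<close> may only move closer
  to \<open>a\<close>. The factor before \<open>cdot\<close> is the derivative of \<open>Moebius_function 0 a\<close> at \<open>b\<close>.
\<close>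
lemma push_towards_curve_contracts:
  assumes D: "open D" "convex D" and G: "left_inverse D f G"
    and f: "holomorphic_curve_on f disc" "f ` disc \<subseteq> D"
    and g: "holomorphic_curve_on g disc" "g ` disc \<subseteq> D"
    and a: "a \<in> disc" "cdot (g a - f a) (cgrad G (f a)) = 0" and b: "b \<in> disc"
  shows "inner (Moebius_function 0 a b)
      ((1 - cnj a * a) / (1 - cnj a * b)\<^sup>2 * cdot (g b - f b) (cgrad G (f b))) \<le> 0"
proof -
  define k where "k = (\<lambda>t l. G (f l + t *\<^sub>R (g l - f l)))"
  define X where "X = (\<lambda>l. cdot (g l - f l) (cgrad G (f l)))"
  have GD: "holomorphic_fun_on G D" "G ` D \<subseteq> ball 0 1" "\<And>l. l \<in> disc \<Longrightarrow> G (f l) = l"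
    using G by (auto simp: left_inverse_def disc_def)
  have k0: "k 0 l = l" if "l \<in> disc" for l
    using GD that by (simp add: k_def)
  have der: "((\<lambda>t. k t l) has_vector_derivative X l) (at 0)" if "l \<in> disc" for l
    unfolding k_def X_def
    by (rule holomorphic_fun_on_segment_derivative [OF GD(1) D(1)]) (use f that in auto)
  have ab: "norm a < 1" "norm b < 1"
    using a b by (auto simp: disc_def)
  have nz: "1 - cnj a * b \<noteq> 0"
    using ab norm_mult_less [of "cnj a" 1 b 1] by auto
  have "norm (Moebius_function 0 (k t a) (k t b)) \<le> norm (Moebius_function 0 a b)"
    if "0 < t" "t < 1" for t
  proof (rule Schwarz_Pick [OF _ _ ab])
    have seg: "f l + t *\<^sub>R (g l - f l) \<in> D" if "l \<in> disc" for l
      using convex_segment_point [OF D(2), of "f l" "g l" t] f g that \<open>0 < t\<close> \<open>t < 1\<close> by auto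
    have "holomorphic_curve_on (\<lambda>l. f l + t *\<^sub>R (g l - f l)) disc"
      using f g unfolding holomorphic_curve_on_def
      by (auto intro!: holomorphic_intros simp: scaleR_conv_of_real)
    then show "k t holomorphic_on ball 0 1"
      unfolding k_def using holomorphic_on_fun_curve [OF GD(1) D(1), of _ disc] seg
      by (auto simp: disc_def image_subset_iff)
    show "k t ` ball 0 1 \<subseteq> ball 0 1"
      using seg GD(2) by (auto simp: k_def disc_def image_subset_iff)
  qed
  then have ev: "\<forall>\<^sub>F t in at_right 0. norm (Moebius_function 0 (k t a) (k t b))
      \<le> norm (Moebius_function 0 (k 0 a) (k 0 b))"
    using a b k0 unfolding eventually_at_right_field by (intro exI [of _ 1]) auto
  \<comment> \<open>As \<open>k t a\<close> has velocity \<open>0\<close>, so has its conjugate, and only the movement of \<open>k t b\<close> counts below.\<close>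
  have da: "((\<lambda>t. cnj (k t a)) has_vector_derivative 0) (at 0)"
    using bounded_linear.has_vector_derivative [OF bounded_linear_cnj der [OF a(1)]] a
    by (simp add: X_def)
  have num: "((\<lambda>t. k t b - k t a) has_vector_derivative X b) (at 0)"
    using has_vector_derivative_diff [OF der [OF b] der [OF a(1)]] a(2) by (simp add: X_def)
  have den: "((\<lambda>t. 1 - cnj (k t a) * k t b) has_vector_derivative - cnj a * X b) (at 0)"
    using has_vector_derivative_diff [OF has_vector_derivative_const
        has_vector_derivative_mult [OF da der [OF b]]] a(1) k0 by simp
  have "((\<lambda>t. (k t b - k t a) / (1 - cnj (k t a) * k t b)) has_derivative
      (\<lambda>t. ((t *\<^sub>R X b) * (1 - cnj a * b) - (b - a) * (t *\<^sub>R (- cnj a * X b)))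
        / ((1 - cnj a * b) * (1 - cnj a * b)))) (at 0)"
    using has_derivative_divide' [OF num [unfolded has_vector_derivative_def]
        den [unfolded has_vector_derivative_def]] nz a(1) b k0 by simp
  moreover have "((t *\<^sub>R X b) * (1 - cnj a * b) - (b - a) * (t *\<^sub>R (- cnj a * X b)))
      / ((1 - cnj a * b) * (1 - cnj a * b)) = t *\<^sub>R ((1 - cnj a * a) / (1 - cnj a * b)\<^sup>2 * X b)" for t
    by (simp add: scaleR_conv_of_real power2_eq_square algebra_simps)
  ultimately have "((\<lambda>t. Moebius_function 0 (k t a) (k t b)) has_vector_derivative
      (1 - cnj a * a) / (1 - cnj a * b)\<^sup>2 * X b) (at 0)"
    by (simp add: has_vector_derivative_def Moebius_function_simple)
  from inner_derivative_nonpos_of_norm_le [OF this ev] show ?thesis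
    using a b k0 by (simp add: X_def)
qed

text \<open>
  The constant curve \<open>z\<close> alone gives only the inequality \<open>0 \<le> 0\<close> at \<open>b\<close>. Since \<open>z\<close> is an interior
  point, one may add a small curve that vanishes at \<open>a\<close> and has an arbitrary direction at \<open>b\<close>.
\<close>
lemma gradient_zero_unique:
  assumes D: "open D" "convex D" and G: "left_inverse D f G"
    and f: "holomorphic_curve_on f disc" "f ` disc \<subseteq> D"
    and z: "z \<in> D"
    and a: "a \<in> disc" "cdot (z - f a) (cgrad G (f a)) = 0"
    and b: "b \<in> disc" "cdot (z - f b) (cgrad G (f b)) = 0"
  shows "a = b"
proof (rule ccontr)
  assume "a \<noteq> b"
  define A where "A = (1 - cnj a * a) / (1 - cnj a * b)\<^sup>2"
  have ab: "norm a < 1" "norm b < 1"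
    using a b by (auto simp: disc_def)
  have "1 - cnj a * b \<noteq> 0" "1 - cnj a * a \<noteq> 0"
    using ab norm_mult_less [of "cnj a" 1 b 1] norm_mult_less [of "cnj a" 1 a 1] by auto
  then have nz: "A \<noteq> 0" "Moebius_function 0 a b \<noteq> 0"
    using \<open>a \<noteq> b\<close> by (auto simp: A_def Moebius_function_simple)
  obtain e where e: "e > 0" "ball z e \<subseteq> D"
    using D(1) z by (meson openE)
  have "cgrad G (f b) $ j = 0" for j
  proof -
    have "inner (Moebius_function 0 a b) (c * (A * ((b - a) * cgrad G (f b) $ j))) \<le> 0"
      \<comment> \<open>The bound \<open>e / 2\<close> accounts for the diameter \<open>2\<close> of the disc.\<close>
      if c: "norm c < e / 2" for c
    proof -
      define g where "g = (\<lambda>l. z + (c * (l - a)) *s axis j 1)"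
      have "holomorphic_curve_on g disc"
        unfolding g_def by (rule holomorphic_curve_on_add_scaled)
          (auto simp: holomorphic_curve_on_def intro!: holomorphic_intros)
      moreover have "g ` disc \<subseteq> D"
      proof (rule order_trans [OF _ e(2)], rule image_subsetI)
        fix l assume "l \<in> disc"
        then have "norm (l - a) \<le> 2"
          using ab norm_triangle_ineq4 [of l a] by (simp add: disc_def)
        then have "norm (c * (l - a)) \<le> norm c * 2"
          by (simp add: norm_mult mult_left_mono)
        with c show "g l \<in> ball z e"
          by (simp add: g_def dist_norm norm_minus_commute norm_scale_axis)
      qed
      moreover have "cdot (g a - f a) (cgrad G (f a)) = 0"
        using a by (simp add: g_def)
      ultimately have "inner (Moebius_function 0 a b) (A * cdot (g b - f b) (cgrad G (f b))) \<le> 0"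
        using push_towards_curve_contracts [OF D G f] a(1) b(1) unfolding A_def by blast
      moreover have "cdot (g b - f b) (cgrad G (f b)) = c * (b - a) * cgrad G (f b) $ j"
        using b(2) by (simp add: g_def cdot.add_left cdot.diff_left cdot_scale_left cdot_axis_left)
      ultimately show ?thesis
        by (simp add: mult_ac)
    qed
    then have "A * ((b - a) * cgrad G (f b) $ j) = 0"
      using zero_if_inner_small_multiples_nonpos [OF nz(2)] e(1) by (meson half_gt_zero)
    with nz \<open>a \<noteq> b\<close> show ?thesis
      by simp
  qed
  then have "cgrad G (f b) = 0"
    by (simp add: vec_eq_iff)
  moreover have "cdot (curve_deriv f b) (cgrad G (f b)) = 1"
    by (rule gradient_pairing_of_section [of G D f b disc disc])
      (use D G f b in \<open>auto simp: left_inverse_def disc_def\<close>)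
  ultimately show False
    by (simp add: cdot.zero_right)
qed

section \<open>Gradients along holomorphic curves are holomorphic\<close>

text \<open>
  The bound depends on \<open>g\<close> only through \<open>M\<close> and \<open>s\<close>, so difference quotients converge uniformly in
  families of functions with a common bound. It combines Taylor's formula with the Cauchy estimate
  for the second derivative on discs of radius \<open>s / 4\<close> around the points of \<open>ball 0 (s / 2)\<close>.
\<close>
lemma holomorphic_difference_quotient_bound:
  assumes hol: "g holomorphic_on ball 0 s" and M: "\<And>t. t \<in> ball 0 s \<Longrightarrow> norm (g t) \<le> M"
    and t: "t \<noteq> 0" "norm t < s / 2"
  shows "norm ((g t - g 0) / t - deriv g 0) \<le> 2 * M / (s / 4)\<^sup>2 * norm t"
proof -
  have s: "s > 0"
    using t norm_ge_zero [of t] by linarith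
  have holn: "(deriv ^^ n) g holomorphic_on ball 0 s" for n
    by (rule holomorphic_higher_deriv [OF hol open_ball])
  have bound: "norm ((deriv ^^ 2) g x) \<le> 2 * M / (s / 4)\<^sup>2" if x: "x \<in> ball 0 (s / 2)" for x
  proof -
    have sub: "cball x (s / 4) \<subseteq> ball 0 s"
    proof
      fix y assume "y \<in> cball x (s / 4)"
      then have "norm y \<le> norm x + s / 4"
        using norm_triangle_sub [of y x] by (simp add: dist_norm norm_minus_commute)
      then show "y \<in> ball 0 s"
        using x s by simp
    qed
    have "norm ((deriv ^^ 2) g x) \<le> fact 2 * M / (s / 4) ^ 2"
    proof (rule Cauchy_inequality)
      show "g holomorphic_on ball x (s / 4)"
        using sub by (intro holomorphic_on_subset [OF hol]) auto
      show "continuous_on (cball x (s / 4)) g"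
        by (rule continuous_on_subset [OF holomorphic_on_imp_continuous_on [OF hol] sub])
      show "norm (g y) \<le> M" if "norm (x - y) = s / 4" for y
        using that sub by (intro M) (auto simp: dist_norm)
    qed (use s in simp)
    then show ?thesis by simp
  qed
  have "norm ((deriv ^^ 0) g t - (\<Sum>i\<le>1. (deriv ^^ i) g 0 * (t - 0) ^ i / fact i))
      \<le> 2 * M / (s / 4)\<^sup>2 * norm (t - 0) ^ Suc 1 / fact 1"
  proof (rule complex_Taylor [where S = "ball 0 (s / 2)"])
    show "((deriv ^^ i) g has_field_derivative (deriv ^^ Suc i) g x) (at x within ball 0 (s / 2))"
      if "x \<in> ball 0 (s / 2)" for i x
      using holomorphic_derivI [OF holn [of i] open_ball] that s by auto
  qed (use bound t s in \<open>auto simp: numeral_2_eq_2\<close>)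
  then have "norm (g t - g 0 - t * deriv g 0) \<le> 2 * M / (s / 4)\<^sup>2 * norm t * norm t"
    by (simp add: power2_eq_square algebra_simps)
  moreover have "g t - g 0 - t * deriv g 0 = ((g t - g 0) / t - deriv g 0) * t"
    using t by (simp add: field_simps)
  ultimately have "norm ((g t - g 0) / t - deriv g 0) * norm t \<le> 2 * M / (s / 4)\<^sup>2 * norm t * norm t"
    by (simp only: norm_mult)
  then show ?thesis
    using t(1) by (simp only: mult_le_cancel_right) (simp add: not_less)
qed

lemma holomorphic_curve_on_imp_continuous_on:
  assumes "holomorphic_curve_on f S"
  shows "continuous_on S f"
proof -
  have "continuous_on S (\<lambda>x. \<chi> j. f x $ j)"
    using assms by (intro continuous_on_vec_lambda)
      (auto simp: holomorphic_curve_on_def intro: holomorphic_on_imp_continuous_on)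
  then show ?thesis by simp
qed

lemma holomorphic_fun_on_imp_continuous_on:
  assumes "holomorphic_fun_on G S"
  shows "continuous_on S G"
  using assms unfolding holomorphic_fun_on_def continuous_on_eq_continuous_within
  by (meson has_derivative_continuous)

lemma holomorphic_curve_on_curve_deriv:
  assumes "holomorphic_curve_on f S" "open S"
  shows "holomorphic_curve_on (curve_deriv f) S"
  using assms by (auto simp: holomorphic_curve_on_def curve_deriv_def intro: holomorphic_deriv)

text \<open>
  Each partial derivative along the curve is a locally uniform limit of difference quotients of \<open>E\<close>,
  which are holomorphic in the curve parameter.
\<close>
lemma holomorphic_gradient_along_curve:
  fixes E :: "complex ^ 'n \<Rightarrow> complex"
  assumes E: "holomorphic_fun_on E V" "open V"
    and F: "holomorphic_curve_on F W" "open W" "F ` W \<subseteq> V"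
  shows "holomorphic_curve_on (\<lambda>l. cgrad E (F l)) W"
  unfolding holomorphic_curve_on_def
proof
  fix j :: 'n
  have "\<exists>r>0. (\<lambda>l. cgrad E (F l) $ j) holomorphic_on ball a r" if a: "a \<in> W" for a
  proof -
    have "F a \<in> V"
      using F(3) a by auto
    then obtain R where R: "R > 0" "cball (F a) R \<subseteq> V"
      using E(2) by (auto simp: open_contains_cball)
    have "isCont F a"
      using holomorphic_curve_on_imp_continuous_on [OF F(1)] F(2) a
      by (simp add: continuous_on_eq_continuous_at)
    then obtain r1 where r1: "r1 > 0" "\<And>l. dist l a < r1 \<Longrightarrow> dist (F l) (F a) < R / 2"
      using R(1) unfolding continuous_at_eps_delta by (metis half_gt_zero)
    obtain r2 where r2: "r2 > 0" "ball a r2 \<subseteq> W"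
      using F(2) a by (meson openE)
    define r where "r = min r1 r2"
    have r: "r > 0" "ball a r \<subseteq> W" "\<And>l. l \<in> ball a r \<Longrightarrow> dist (F l) (F a) < R / 2"
      using r1 r2 by (auto simp: r_def dist_commute)
    have near: "F l + t *s axis j 1 \<in> cball (F a) R" if "l \<in> ball a r" "norm t \<le> R / 2" for l t
    proof -
      have "dist (F a) (F l + t *s axis j 1) \<le> dist (F a) (F l) + norm t"
        using norm_triangle_ineq4 [of "F a - F l" "t *s axis j 1"]
        by (simp add: dist_norm norm_scale_axis algebra_simps)
      then show ?thesis
        using r(3) [OF that(1)] that(2) by (simp add: dist_commute)
    qed
    have "compact (E ` cball (F a) R)"
      by (rule compact_continuous_image [OF continuous_on_subset
            [OF holomorphic_fun_on_imp_continuous_on [OF E(1)] R(2)]]) simp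
    then obtain M where M: "\<And>x. x \<in> cball (F a) R \<Longrightarrow> norm (E x) \<le> M"
      by (metis bounded_iff compact_imp_bounded image_eqI)
    \<comment> \<open>Steps tending to \<open>0\<close>, of length less than half the radius \<open>R / 2\<close> of the discs on which \<open>E\<close> is differentiated.\<close>
    define t :: "nat \<Rightarrow> complex" where "t = (\<lambda>n. of_real (R / 8 / real (Suc n)))"
    have nt: "norm (t n) = R / 8 / real (Suc n)" for n
      using R(1) by (simp add: t_def norm_divide del: of_nat_Suc)
    have tb: "norm (t n) < (R / 2) / 2" for n
    proof -
      have "R / 8 / real (Suc n) \<le> R / 8 / 1"
        using R(1) by (intro divide_left_mono) auto
      also have "R / 8 / 1 < (R / 2) / 2"
        using R(1) by simp
      finally show ?thesis
        unfolding nt .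
    qed
    have t0: "t n \<noteq> 0" for n
      using R(1) by (simp add: t_def del: of_nat_Suc)
    define q where "q = (\<lambda>n l. (E (F l + t n *s axis j 1) - E (F l)) / t n)"
    have "(\<lambda>l. cgrad E (F l) $ j) holomorphic_on ball a r"
    proof (rule holomorphic_uniform_sequence [OF open_ball])
      fix n
      have Fr: "holomorphic_curve_on F (ball a r)"
        using F(1) r(2) by (auto simp: holomorphic_curve_on_def intro: holomorphic_on_subset)
      have "(\<lambda>l. E (F l + t n *s axis j 1)) holomorphic_on ball a r"
        by (rule holomorphic_on_fun_curve [OF E holomorphic_curve_on_add_scaled [OF Fr] open_ball])
          (use near [of _ "t n"] tb [of n] R in auto)
      moreover have "(\<lambda>l. E (F l)) holomorphic_on ball a r"
        by (rule holomorphic_on_fun_curve [OF E Fr open_ball]) (use r(2) F(3) in auto)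
      ultimately show "q n holomorphic_on ball a r"
        unfolding q_def using t0
        by (intro holomorphic_on_divide holomorphic_on_diff holomorphic_on_const)
    next
      have err: "norm (q n l - cgrad E (F l) $ j) \<le> 2 * M / (R / 2 / 4)\<^sup>2 * norm (t n)"
        if l: "l \<in> ball a r" for n l
      proof -
        define g where "g = (\<lambda>t. E (F l + t *s axis j 1))"
        have "holomorphic_curve_on (\<lambda>t. F l + t *s axis j 1) (ball 0 (R / 2))"
          by (rule holomorphic_curve_on_add_scaled)
            (auto simp: holomorphic_curve_on_def intro!: holomorphic_intros)
        then have "g holomorphic_on ball 0 (R / 2)"
          unfolding g_def
          by (rule holomorphic_on_fun_curve [OF E _ open_ball]) (use near [OF l] R in auto)
        moreover have "norm (g t) \<le> M" if "t \<in> ball 0 (R / 2)" for t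
          unfolding g_def using that by (intro M near l) auto
        ultimately have "norm ((g (t n) - g 0) / t n - deriv g 0) \<le> 2 * M / (R / 2 / 4)\<^sup>2 * norm (t n)"
          using tb t0 by (intro holomorphic_difference_quotient_bound) auto
        then show ?thesis
          by (simp add: g_def q_def cgrad_def)
      qed
      have "(\<lambda>n. 2 * M / (R / 2 / 4)\<^sup>2 * norm (t n)) \<longlonglongrightarrow> 2 * M / (R / 2 / 4)\<^sup>2 * 0"
        unfolding nt by (rule tendsto_mult_left [OF LIMSEQ_Suc [OF lim_const_over_n]])
      then have lim: "(\<lambda>n. 2 * M / (R / 2 / 4)\<^sup>2 * norm (t n)) \<longlonglongrightarrow> 0"
        by simp
      have unif: "uniform_limit (ball a r) q (\<lambda>l. cgrad E (F l) $ j) sequentially"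
      proof (rule uniform_limitI)
        fix e :: real assume "e > 0"
        then have "\<forall>\<^sub>F n in sequentially. 2 * M / (R / 2 / 4)\<^sup>2 * norm (t n) < e"
          by (rule order_tendstoD(2) [OF lim])
        then show "\<forall>\<^sub>F n in sequentially. \<forall>l\<in>ball a r. dist (q n l) (cgrad E (F l) $ j) < e"
        proof eventually_elim
          case (elim n)
          then show ?case
            unfolding dist_norm by (intro ballI le_less_trans [OF err])
        qed
      qed
      fix x assume "x \<in> ball a r"
      then obtain d where "d > 0" "cball x d \<subseteq> ball a r"
        by (meson open_ball open_contains_cball)
      then show "\<exists>d>0. cball x d \<subseteq> ball a r \<and>
          uniform_limit (cball x d) q (\<lambda>l. cgrad E (F l) $ j) sequentially"
        using uniform_limit_on_subset [OF unif] by blast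
    qed
    with r(1) show ?thesis by blast
  qed
  then show "(\<lambda>l. cgrad E (F l) $ j) holomorphic_on W"
    unfolding holomorphic_on_open [OF F(2)]
    by (metis centre_in_ball holomorphic_derivI open_ball)
qed

section \<open>The implicit function\<close>

text \<open>
  The Caratheodory form of differentiability: a factorisation of the increment with a factor that has
  a limit already gives the derivative. It is convenient for implicit functions, whose increments come
  in factored form.
\<close>
lemma has_derivative_of_cdot_factor:
  fixes k :: "complex ^ 'n \<Rightarrow> complex ^ 'n"
  assumes "\<forall>\<^sub>F y in at x. f y = f x + cdot (y - x) (k y)" and k: "(k \<longlongrightarrow> k0) (at x)"
  shows "(f has_derivative (\<lambda>v. cdot v k0)) (at x)"
proof -
  obtain K where K: "K \<ge> 0" "\<And>a b :: complex ^ 'n. norm (cdot a b) \<le> norm a * norm b * K"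
    using cdot.nonneg_bounded by auto
  have "((\<lambda>y. norm (f y - f x - cdot (y - x) k0) / norm (y - x)) \<longlongrightarrow> 0) (at x)"
  proof (rule Lim_null_comparison)
    show "\<forall>\<^sub>F y in at x. norm (norm (f y - f x - cdot (y - x) k0) / norm (y - x)) \<le> norm (k y - k0) * K"
      using assms(1) eventually_neq_at_within [of x]
    proof eventually_elim
      case (elim y)
      then have "norm (f y - f x - cdot (y - x) k0) \<le> norm (y - x) * norm (k y - k0) * K"
        using K(2) [of "y - x" "k y - k0"] by (simp add: cdot.diff_right)
      with elim show ?case
        by (simp add: divide_le_eq algebra_simps)
    qed
    have "((\<lambda>y. norm (k y - k0) * K) \<longlongrightarrow> norm (k0 - k0) * K) (at x)"
      by (intro tendsto_intros k)
    then show "((\<lambda>y. norm (k y - k0) * K) \<longlongrightarrow> 0) (at x)"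
      by simp
  qed
  then show ?thesis
    by (simp add: has_derivative_iff_norm cdot.bounded_linear_left)
qed

text \<open>
  The hyperplanes through \<open>p l\<close> with normal \<open>w l\<close> sweep out a neighbourhood of \<open>p l0\<close>, because the
  curve \<open>p\<close> crosses the hyperplane at \<open>l0\<close> transversally. The parameter of the hyperplane through \<open>z\<close>
  is the fixed point of a Newton-like contraction with the slope frozen at the base point.
\<close>
lemma implicit_hyperplane_parameter:
  fixes p w :: "complex \<Rightarrow> complex ^ 'n"
  assumes W: "open W" "l0 \<in> W" and p: "holomorphic_curve_on p W" and w: "holomorphic_curve_on w W"
    and c: "cdot (curve_deriv p l0) (w l0) \<noteq> 0"
  obtains r d h where "r > 0" "d > 0" "ball l0 r \<subseteq> W" "holomorphic_fun_on h (ball (p l0) d)"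
    "\<And>z. z \<in> ball (p l0) d \<Longrightarrow> h z \<in> ball l0 r \<and> cdot (z - p (h z)) (w (h z)) = 0"
    "\<And>z l. z \<in> ball (p l0) d \<Longrightarrow> l \<in> ball l0 r \<Longrightarrow> cdot (z - p l) (w l) = 0 \<Longrightarrow> l = h z"
proof -
  define c where "c = cdot (curve_deriv p l0) (w l0)"
  define P where "P = (\<lambda>z l. cdot (z - p l) (w l))"
  define Q where "Q = (\<lambda>z l. cdot (z - p l) (curve_deriv w l) - cdot (curve_deriv p l) (w l))"
  have c0: "c \<noteq> 0" using c by (simp add: c_def)
  \<comment> \<open>\<open>Q\<close> is the \<open>l\<close>-derivative of \<open>P\<close>; at the base point it equals \<open>- c\<close>.\<close>
  have dP: "(P z has_field_derivative Q z l) (at l)" if "l \<in> W" for z l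
  proof -
    have "((\<lambda>l. cdot (z - p l) (w l)) has_derivative
        (\<lambda>t. cdot (z - p l) (t *s curve_deriv w l) + cdot (0 - t *s curve_deriv p l) (w l))) (at l)"
      by (intro cdot.FDERIV has_derivative_diff has_derivative_const
          holomorphic_curve_on_has_derivative [OF p W(1) that]
          holomorphic_curve_on_has_derivative [OF w W(1) that])
    then show ?thesis unfolding P_def Q_def
      by (rule has_derivative_imp_has_field_derivative)
        (simp add: cdot.minus_left cdot_scale_left cdot_commute [of _ "_ *s _"]
          cdot_commute [of "curve_deriv w l"] algebra_simps)
  qed
  note contW = p w holomorphic_curve_on_curve_deriv [OF p W(1)] holomorphic_curve_on_curve_deriv [OF w W(1)]
  have "continuous_on (UNIV \<times> W) (\<lambda>x. Q (fst x) (snd x))"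
    unfolding Q_def
    by (intro cdot.continuous_on continuous_intros contW [THEN holomorphic_curve_on_imp_continuous_on,
          THEN continuous_on_compose2]) auto
  then have "isCont (\<lambda>x. Q (fst x) (snd x)) (p l0, l0)"
    using W by (simp add: continuous_on_eq_continuous_at open_Times)
  then obtain e where e: "e > 0" "\<And>x. dist x (p l0, l0) < e \<Longrightarrow>
      dist (Q (fst x) (snd x)) (Q (p l0) l0) < norm c / 2"
    using c0 unfolding continuous_at_eps_delta by (metis (no_types, lifting) fst_conv half_gt_zero snd_conv zero_less_norm_iff)
  have Q0: "Q (p l0) l0 = - c"
    by (simp add: Q_def c_def cdot.zero_left)
  obtain r0 where r0: "r0 > 0" "cball l0 r0 \<subseteq> W"
    using W by (meson open_contains_cball)
  define r where "r = min r0 (e / 4)"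
  have r: "r > 0" "cball l0 r \<subseteq> W"
    using r0 e by (auto simp: r_def)
  have Qb: "norm (Q z l + c) < norm c / 2" if "dist z (p l0) < e / 2" "l \<in> cball l0 r" for z l
  proof -
    have "dist (z, l) (p l0, l0) \<le> dist z (p l0) + dist l l0"
      by (simp add: dist_Pair_Pair sqrt_sum_squares_le_sum)
    also have "\<dots> < e"
      using that e(1) by (auto simp: r_def dist_commute)
    finally show ?thesis
      using e(2) [of "(z, l)"] by (simp add: Q0 dist_norm)
  qed
  obtain d1 where d1: "d1 > 0" "\<And>z. dist z (p l0) < d1 \<Longrightarrow> norm (cdot (z - p l0) (w l0)) < norm c * r / 2"
  proof -
    have "isCont (\<lambda>z. cdot (z - p l0) (w l0)) (p l0)"
      by (intro cdot.isCont continuous_intros)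
    then obtain d1 where "d1 > 0" "\<And>z. dist z (p l0) < d1 \<Longrightarrow>
        dist (cdot (z - p l0) (w l0)) (cdot (p l0 - p l0) (w l0)) < norm c * r / 2"
      using c0 r(1) unfolding continuous_at_eps_delta
      by (metis half_gt_zero mult_pos_pos zero_less_norm_iff)
    then show thesis
      using that by (simp add: cdot.zero_left)
  qed
  define d where "d = min d1 (e / 2)"
  have d: "d > 0" using d1 e by (simp add: d_def)
  \<comment> \<open>\<open>Psi z\<close> has derivative \<open>(Q z l + c) / c\<close>, small near the base point, and its fixed points are the zeros of \<open>P z\<close>.\<close>
  define Psi where "Psi = (\<lambda>z l. l + P z l / c)"
  have lip: "norm (Psi z l - Psi z m) \<le> 1 / 2 * norm (l - m)"
    if z: "z \<in> ball (p l0) d" and "l \<in> cball l0 r" "m \<in> cball l0 r" for z l m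
  proof (rule field_differentiable_bound [OF convex_cball _ _ that(2,3)])
    fix x assume x: "x \<in> cball l0 r"
    show "(Psi z has_field_derivative 1 + Q z x / c) (at x within cball l0 r)"
      unfolding Psi_def using x r(2) c0
      by (auto intro!: derivative_eq_intros has_field_derivative_at_within [OF dP])
    have "1 + Q z x / c = (Q z x + c) / c"
      using c0 by (simp add: field_simps)
    then show "norm (1 + Q z x / c) \<le> 1 / 2"
      using Qb [OF _ x, of z] z c0 by (simp add: norm_divide d_def dist_commute divide_le_eq)
  qed
  have into: "Psi z l \<in> ball l0 r" if z: "z \<in> ball (p l0) d" and l: "l \<in> cball l0 r" for z l
  proof -
    have "norm (Psi z l - l0) \<le> norm (Psi z l - Psi z l0) + norm (Psi z l0 - l0)"
      using norm_triangle_ineq [of "Psi z l - Psi z l0" "Psi z l0 - l0"] by simp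
    moreover have "norm (Psi z l - Psi z l0) \<le> r / 2"
      using lip [OF z l, of l0] l r(1) by (simp add: dist_norm norm_minus_commute)
    moreover have "norm (Psi z l0 - l0) < r / 2"
      using d1(2) [of z] z c0
      by (simp add: Psi_def P_def d_def norm_divide dist_commute divide_less_eq mult.commute)
    ultimately show ?thesis
      by (simp add: dist_norm norm_minus_commute)
  qed
  have fix_iff: "Psi z l = l \<longleftrightarrow> P z l = 0" for z l
    using c0 by (simp add: Psi_def)
  have ex1: "\<exists>!l\<in>cball l0 r. Psi z l = l" if z: "z \<in> ball (p l0) d" for z
  proof (rule Banach_fix [where c = "1 / 2"])
    show "Psi z ` cball l0 r \<subseteq> cball l0 r"
      using into [OF z] by force
  qed (use lip [OF z] r(1) in \<open>auto simp: dist_norm complete_eq_closed\<close>)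
  define h where "h = (\<lambda>z. THE l. l \<in> cball l0 r \<and> Psi z l = l)"
  have h: "h z \<in> cball l0 r" "Psi z (h z) = h z" if "z \<in> ball (p l0) d" for z
    using theI' [OF ex1 [OF that]] by (auto simp: h_def)
  have hball: "h z \<in> ball l0 r" if "z \<in> ball (p l0) d" for z
    using into [OF that h(1) [OF that]] h(2) [OF that] by simp
  have hP: "P z (h z) = 0" if "z \<in> ball (p l0) d" for z
    using h [OF that] fix_iff by simp
  have huniq: "l = h z" if "z \<in> ball (p l0) d" "l \<in> cball l0 r" "P z l = 0" for z l
    using ex1 [OF that(1)] h [OF that(1)] that fix_iff by blast
  have hcont: "(h \<longlongrightarrow> h x) (at x)" if x: "x \<in> ball (p l0) d" for x
  proof (rule Lim_transform)
    show "((\<lambda>y. h x) \<longlongrightarrow> h x) (at x)" by simp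
    have "((\<lambda>y. 2 * norm (cdot (y - x) (w (h x)) / c)) \<longlongrightarrow> 2 * norm (cdot (x - x) (w (h x)) / c)) (at x)"
      using c0 by (intro tendsto_intros cdot.tendsto) auto
    then have lim: "((\<lambda>y. 2 * norm (cdot (y - x) (w (h x)) / c)) \<longlongrightarrow> 0) (at x)"
      by (simp add: cdot.zero_left)
    show "((\<lambda>y. h y - h x) \<longlongrightarrow> 0) (at x)"
    proof (rule Lim_null_comparison [OF _ lim])
      have "\<forall>\<^sub>F y in at x. y \<in> ball (p l0) d"
        using eventually_at_in_open' [OF open_ball x] .
      then show "\<forall>\<^sub>F y in at x. norm (h y - h x) \<le> 2 * norm (cdot (y - x) (w (h x)) / c)"
      proof eventually_elim
        case (elim y)
        have "h x - h y = (Psi y (h x) - Psi y (h y)) + (Psi x (h x) - Psi y (h x))"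
          using h(2) [OF x] h(2) [OF elim] by simp
        moreover have "Psi x (h x) - Psi y (h x) = - (cdot (y - x) (w (h x)) / c)"
          by (simp add: Psi_def P_def cdot.diff_left diff_divide_distrib)
        ultimately have "norm (h x - h y) \<le> norm (Psi y (h x) - Psi y (h y)) + norm (cdot (y - x) (w (h x)) / c)"
          by (metis norm_minus_cancel norm_triangle_ineq)
        then have "norm (h y - h x) \<le> norm (Psi y (h x) - Psi y (h y)) + norm (cdot (y - x) (w (h x)) / c)"
          by (simp only: norm_minus_commute)
        with lip [OF elim h(1) [OF x] h(1) [OF elim]] show ?case
          by (simp add: norm_minus_commute)
      qed
    qed
  qed
  have "holomorphic_fun_on h (ball (p l0) d)"
    unfolding holomorphic_fun_on_def
  proof (intro ballI)
    fix x assume x: "x \<in> ball (p l0) d"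
    have hxW: "h x \<in> W"
      using h(1) [OF x] r(2) by auto
    \<comment> \<open>With \<open>P x l = q l * (l - h x)\<close>, the equation \<open>P y (h y) = 0\<close> can be solved for the increment of \<open>h\<close>.\<close>
    obtain q where q: "\<And>l. P x l - P x (h x) = q l * (l - h x)" "isCont q (h x)" "q (h x) = Q x (h x)"
      using dP [OF hxW, of x] unfolding CARAT_DERIV by auto
    have "norm (Q x (h x) + c) < norm c / 2"
      using x by (intro Qb h(1)) (auto simp: d_def dist_commute)
    then have q0: "q (h x) \<noteq> 0"
      using q(3) by auto
    have qlim: "((\<lambda>y. q (h y)) \<longlongrightarrow> q (h x)) (at x)"
      by (rule isCont_tendsto_compose [OF q(2) hcont [OF x]])
    have wlim: "((\<lambda>y. w (h y)) \<longlongrightarrow> w (h x)) (at x)"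
      using holomorphic_curve_on_imp_continuous_on [OF w] hxW W(1)
      by (intro isCont_tendsto_compose [OF _ hcont [OF x]])
        (simp add: continuous_on_eq_continuous_at)
    define k where "k = (\<lambda>y. \<chi> j. - (w (h y) $ j / q (h y)))"
    have "(k \<longlongrightarrow> k x) (at x)"
      unfolding k_def by (intro tendsto_vec_lambda tendsto_minus tendsto_divide tendsto_vec_nth wlim qlim q0)
    moreover have "\<forall>\<^sub>F y in at x. h y = h x + cdot (y - x) (k y)"
    proof -
      have "\<forall>\<^sub>F y in at x. y \<in> ball (p l0) d"
        using eventually_at_in_open' [OF open_ball x] .
      moreover have "\<forall>\<^sub>F y in at x. q (h y) \<noteq> 0"
        using qlim q0 by (rule tendsto_imp_eventually_ne)
      ultimately show ?thesis
      proof eventually_elim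
        case (elim y)
        have "0 = P y (h y)" using hP elim by simp
        also have "\<dots> = cdot (y - x) (w (h y)) + P x (h y)"
          by (simp add: P_def cdot.diff_left)
        also have "P x (h y) = q (h y) * (h y - h x)"
          using q(1) [of "h y"] hP [OF x] by simp
        finally have "h y = h x - cdot (y - x) (w (h y)) / q (h y)"
          using elim by (simp add: field_simps)
        also have "\<dots> = h x + cdot (y - x) (k y)"
          by (simp add: k_def cdot_def sum_negf sum_divide_distrib)
        finally show ?case .
      qed
    qed
    ultimately have "(h has_derivative (\<lambda>v. cdot v (k x))) (at x)"
      by (intro has_derivative_of_cdot_factor)
    then show "\<exists>L. (h has_derivative L) (at x within ball (p l0) d) \<and> (\<forall>c v. L (c *s v) = c * L v)"
      using cdot_scale_left has_derivative_at_withinI by blast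
  qed
  then show thesis
    using r d hball hP huniq unfolding P_def
    by (intro that [of r d h]) auto
qed

section \<open>Behaviour at the boundary\<close>

text \<open>
  Along segments from \<open>x\<close> into \<open>D\<close> the modulus of \<open>E\<close> does not exceed its initial value, so the
  derivative of \<open>E\<close> at \<open>x\<close> maps \<open>y - x\<close>, for \<open>y\<close> in \<open>D\<close>, into a half-plane. It maps \<open>z - x\<close> to \<open>0\<close> and
  \<open>z\<close> is an interior point, so the half-plane contains the image of a ball around \<open>0\<close>; a
  complex-linear functional with that property is \<open>0\<close>.
\<close>
lemma boundary_gradient_zero:
  assumes D: "open D" "convex D" and E: "holomorphic_fun_on E V" "open V"
    and le: "\<And>y. y \<in> D \<inter> V \<Longrightarrow> norm (E y) \<le> norm (E x)"
    and x: "x \<in> closure D" "x \<in> V" "E x \<noteq> 0"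
    and z: "z \<in> D" "cdot (z - x) (cgrad E x) = 0"
  shows "cgrad E x = 0"
proof -
  obtain e where e: "e > 0" "ball z e \<subseteq> D"
    using D(1) z by (meson openE)
  have "cgrad E x $ j = 0" for j
  proof (rule zero_if_inner_small_multiples_nonpos [OF x(3) e(1)])
    fix c :: complex assume c: "norm c < e"
    define y where "y = z + c *s axis j 1"
    have yD: "y \<in> interior D"
      using c e D(1) by (auto simp: y_def interior_open dist_norm norm_scale_axis intro!: subsetD [OF e(2)])
    have "((\<lambda>t::real. E (x + t *\<^sub>R (y - x))) has_vector_derivative cdot (y - x) (cgrad E x)) (at 0)"
      by (rule holomorphic_fun_on_segment_derivative [OF E x(2)])
    moreover have "\<forall>\<^sub>F t::real in at_right 0. norm (E (x + t *\<^sub>R (y - x))) \<le> norm (E (x + 0 *\<^sub>R (y - x)))"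
    proof -
      have "((\<lambda>t::real. x + t *\<^sub>R (y - x)) \<longlongrightarrow> x + 0 *\<^sub>R (y - x)) (at_right 0)"
        by (intro tendsto_intros)
      then have "\<forall>\<^sub>F t::real in at_right 0. x + t *\<^sub>R (y - x) \<in> V"
        using topological_tendstoD [OF _ E(2)] x(2) by fastforce
      moreover have "\<forall>\<^sub>F t::real in at_right 0. 0 < t \<and> t < 1"
        unfolding eventually_at_right_field by (intro exI [of _ 1]) auto
      ultimately show ?thesis
      proof eventually_elim
        case (elim t)
        have "x - t *\<^sub>R (x - y) \<in> interior D"
          using elim yD x(1) by (intro mem_interior_closure_convex_shrink [OF D(2)]) auto
        moreover have "x - t *\<^sub>R (x - y) = x + t *\<^sub>R (y - x)"
          by (simp add: algebra_simps)
        ultimately show ?case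
          using elim D(1) le by (simp add: interior_open)
      qed
    qed
    ultimately have "inner (E (x + 0 *\<^sub>R (y - x))) (cdot (y - x) (cgrad E x)) \<le> 0"
      by (rule inner_derivative_nonpos_of_norm_le)
    moreover have "cdot (y - x) (cgrad E x) = c * cgrad E x $ j"
      using z(2) by (simp add: y_def cdot.add_left cdot.diff_left cdot_scale_left cdot_axis_left)
    ultimately show "inner (E x) (c * cgrad E x $ j) \<le> 0"
      by simp
  qed
  then show ?thesis by (simp add: vec_eq_iff)
qed

section \<open>Extension of the Lempert left inverse\<close>

lemma cgrad_eq_of_eq_on:
  assumes "holomorphic_fun_on G S" "open S" "holomorphic_fun_on E V" "open V"
    and "\<And>y. y \<in> V \<inter> S \<Longrightarrow> E y = G y" and x: "x \<in> V" "x \<in> S"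
  shows "cgrad E x = cgrad G x"
proof -
  have "(G has_derivative (\<lambda>v. cdot v (cgrad E x))) (at x)"
    by (rule has_derivative_transform_within_open [OF holomorphic_fun_on_has_derivative [OF assms(3,4) x(1)],
          of "V \<inter> S"]) (use assms in auto)
  then have "(\<lambda>v. cdot v (cgrad E x)) = (\<lambda>v. cdot v (cgrad G x))"
    by (rule has_derivative_unique) (rule holomorphic_fun_on_has_derivative [OF assms(1,2) x(2)])
  then have "cdot (axis j 1) (cgrad E x) = cdot (axis j 1) (cgrad G x)" for j
    by metis
  then show ?thesis
    by (simp add: vec_eq_iff cdot_axis_left)
qed

lemma eq_on_open_Int_closure:
  fixes f g :: "'a::topological_space \<Rightarrow> 'b::t2_space"
  assumes "open W" "continuous_on W f" "continuous_on W g"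
    and "\<And>x. x \<in> W \<inter> S \<Longrightarrow> f x = g x" and "x \<in> W \<inter> closure S"
  shows "f x = g x"
proof (rule ccontr)
  assume "f x \<noteq> g x"
  then obtain A B where AB: "open A" "open B" "f x \<in> A" "g x \<in> B" "A \<inter> B = {}"
    by (meson hausdorff)
  define N where "N = (f -` A \<inter> W) \<inter> (g -` B \<inter> W)"
  have "open N"
    unfolding N_def using assms(1-3) AB
    by (intro open_Int [of "f -` A \<inter> W"]) (auto simp: continuous_on_open_vimage)
  moreover have "x \<in> N"
    using assms(5) AB by (simp add: N_def)
  ultimately obtain y where "y \<in> S" "y \<in> N"
    using assms(5) by (auto simp: closure_iff_nhds_not_empty)
  then show False
    using assms(4) [of y] AB by (auto simp: N_def)
qed

theorem corollary3p2:
  fixes D :: "(complex ^ 'n) set"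
    and f F :: "complex \<Rightarrow> complex ^ 'n"
    and G :: "complex ^ 'n \<Rightarrow> complex"
    and l0 :: complex
    and U :: "complex set"
  assumes "open D" "convex D" "bounded D"
    and "complex_geodesic D f"
    and "left_inverse D f G"
    and "l0 \<in> closure disc"
    and "curve_extension_through disc f l0 U F"
    and "F l0 \<in> frontier D"
    and "fun_extends_through D G (F l0)"
  shows "fun_extends_through D (lempert_left_inverse f G) (F l0)"
proof -
  note D = assms(1,2) and l0 = assms(6)
  have f: "holomorphic_curve_on f disc" "f ` disc \<subseteq> D"
    using assms(4) by (auto simp: complex_geodesic_def)
  have G: "holomorphic_fun_on G D" "G ` D \<subseteq> disc" "\<And>l. l \<in> disc \<Longrightarrow> G (f l) = l"
    using assms(5) by (auto simp: left_inverse_def)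
  have F: "open U" "l0 \<in> U" "holomorphic_curve_on F U" "\<And>l. l \<in> U \<inter> disc \<Longrightarrow> F l = f l"
    using assms(7) by (auto simp: curve_extension_through_def)
  obtain V E where E: "open V" "F l0 \<in> V" "holomorphic_fun_on E V" "\<And>y. y \<in> V \<inter> D \<Longrightarrow> E y = G y"
    using assms(9) by (auto simp: fun_extends_through_def)
  define W where "W = F -` V \<inter> U"
  have W: "open W" "l0 \<in> W" "W \<subseteq> U" "F ` W \<subseteq> V"
    using holomorphic_curve_on_imp_continuous_on [OF F(3)] F E
    by (auto simp: W_def continuous_on_open_vimage)
  have FW: "holomorphic_curve_on F W"
    using F(3) W(3) by (auto simp: holomorphic_curve_on_def intro: holomorphic_on_subset)
  note Fcont = holomorphic_curve_on_imp_continuous_on [OF FW]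
  define w where "w = (\<lambda>l. cgrad E (F l))"
  have w: "holomorphic_curve_on w W"
    unfolding w_def by (rule holomorphic_gradient_along_curve [OF E(3,1) FW W(1,4)])
  have disc_in: "f l \<in> D" "F l = f l" "E (F l) = l" if "l \<in> W \<inter> disc" for l
  proof -
    show "f l \<in> D" "F l = f l"
      using that f F(4) W(3) by auto
    then show "E (F l) = l"
      using that W(4) E(4) [of "F l"] G(3) [of l] by auto
  qed
  have section_bd: "E (F l) = l" if "l \<in> W \<inter> closure disc" for l
    by (rule eq_on_open_Int_closure [OF W(1) _ _ disc_in(3) that])
      (auto intro: holomorphic_on_imp_continuous_on
        holomorphic_on_fun_curve [OF E(3,1) FW W(1,4)] continuous_on_id)
  have pairing: "cdot (curve_deriv F l) (w l) = 1" if "l \<in> W \<inter> closure disc" for l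
  proof (rule eq_on_open_Int_closure [OF W(1) _ continuous_on_const _ that])
    show "continuous_on W (\<lambda>l. cdot (curve_deriv F l) (w l))"
      by (intro cdot.continuous_on holomorphic_curve_on_imp_continuous_on w
          holomorphic_curve_on_curve_deriv FW W)
    fix l assume l: "l \<in> W \<inter> disc"
    have "open (W \<inter> disc)"
      using W(1) by (simp add: disc_def open_Int)
    then show "cdot (curve_deriv F l) (w l) = 1"
      unfolding w_def using l disc_in(3) W(4)
      by (intro gradient_pairing_of_section [OF E(3,1) _ FW W(1)]) auto
  qed
  have F_closure: "F l \<in> closure D" if "l \<in> W \<inter> closure disc" for l
  proof -
    have "l \<in> closure (W \<inter> disc)"
      using that W(1) open_Int_closure_subset by blast
    then obtain x where x: "\<And>n. x n \<in> W \<inter> disc" "x \<longlonglongrightarrow> l"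
      by (auto simp: closure_sequential)
    then have "(\<lambda>n. F (x n)) \<longlonglongrightarrow> F l"
      using Fcont W(1) that x(2)
      by (intro isCont_tendsto_compose [of l F]) (auto simp: continuous_on_eq_continuous_at)
    moreover have "F (x n) \<in> D" for n
      using disc_in(1,2) [OF x(1)] by simp
    ultimately show ?thesis
      unfolding closure_sequential by (intro exI [of _ "\<lambda>n. F (x n)"]) simp
  qed
  have "cdot (curve_deriv F l0) (w l0) \<noteq> 0"
    using pairing [of l0] W l0 by simp
  from implicit_hyperplane_parameter [OF W(1,2) FW w this] obtain r d h where
    r: "r > 0" "d > 0" "ball l0 r \<subseteq> W" and h: "holomorphic_fun_on h (ball (F l0) d)"
    and h0: "\<And>z. z \<in> ball (F l0) d \<Longrightarrow> h z \<in> ball l0 r \<and> cdot (z - F (h z)) (w (h z)) = 0"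
    and hu: "\<And>z l. z \<in> ball (F l0) d \<Longrightarrow> l \<in> ball l0 r \<Longrightarrow> cdot (z - F l) (w l) = 0 \<Longrightarrow> l = h z"
    by blast
  define B where "B = ball (F l0) d \<inter> D"
  \<comment> \<open>It remains to show that \<open>h\<close> is the Lempert left inverse on \<open>B\<close>.\<close>
  have not_circle: "norm (h z) \<noteq> 1" if z: "z \<in> B" for z
  proof
    assume n: "norm (h z) = 1"
    then have hz: "h z \<in> W \<inter> closure disc"
      using z h0 [of z] r(3) by (auto simp: B_def disc_def)
    have "cgrad E (F (h z)) = 0"
    proof (rule boundary_gradient_zero [OF D E(3,1)])
      show "norm (E y) \<le> norm (E (F (h z)))" if "y \<in> D \<inter> V" for y
        using that E(4) [of y] G(2) section_bd [OF hz] n by (force simp: disc_def)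
      show "F (h z) \<in> closure D" "F (h z) \<in> V" "E (F (h z)) \<noteq> 0"
        using F_closure [OF hz] hz W(4) section_bd [OF hz] n by auto
      show "z \<in> D" "cdot (z - F (h z)) (cgrad E (F (h z))) = 0"
        using z h0 [of z] by (auto simp: B_def w_def)
    qed
    then show False
      using pairing [OF hz] by (simp add: w_def cdot.zero_right)
  qed
  \<comment> \<open>On the curve itself \<open>h\<close> inverts \<open>F\<close>, which gives one point of \<open>B\<close> where \<open>h\<close> is in the disc.\<close>
  obtain l1 where l1: "l1 \<in> disc" "l1 \<in> ball l0 r" "F l1 \<in> B"
  proof -
    define N where "N = F -` ball (F l0) d \<inter> W \<inter> ball l0 r"
    have "open N"
      unfolding N_def using Fcont W(1)
      by (intro open_Int [OF _ open_ball]) (simp add: continuous_on_open_vimage)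
    have "l0 \<in> N \<inter> closure disc"
      using r W l0 by (simp add: N_def)
    then have "N \<inter> disc \<noteq> {}"
      using open_Int_closure_eq_empty [OF \<open>open N\<close>, of disc] by auto
    then obtain l where "l \<in> disc" "l \<in> F -` ball (F l0) d \<inter> W \<inter> ball l0 r"
      unfolding N_def by blast
    then show thesis
      using disc_in [of l] by (intro that [of l]) (auto simp: B_def)
  qed
  have "l1 = h (F l1)"
    using l1 by (intro hu) (auto simp: B_def cdot.zero_left)
  have in_disc: "h z \<in> disc" if z: "z \<in> B" for z
  proof (rule ccontr)
    assume "h z \<notin> disc"
    have "connected B"
      unfolding B_def using D(2) by (intro convex_connected convex_Int convex_ball)
    moreover have "continuous_on B (\<lambda>z. norm (h z))"
      using holomorphic_fun_on_imp_continuous_on [OF h]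
      by (intro continuous_on_norm) (auto simp: B_def intro: continuous_on_subset)
    ultimately have "connected ((\<lambda>z. norm (h z)) ` B)"
      by (rule connected_continuous_image [rotated])
    moreover have "norm (h (F l1)) \<le> 1" "1 \<le> norm (h z)"
      using l1(1) \<open>l1 = h (F l1)\<close> \<open>h z \<notin> disc\<close> by (auto simp: disc_def)
    ultimately have "1 \<in> (\<lambda>z. norm (h z)) ` B"
      using z l1(3) by (meson connected_contains_Icc atLeastAtMost_iff imageI subsetD)
    with not_circle show False by auto
  qed
  have "h z = lempert_left_inverse f G z" if z: "z \<in> B" for z
  proof -
    have hz: "h z \<in> W \<inter> disc"
      using z h0 [of z] r(3) in_disc [OF z] by (auto simp: B_def)
    have "cgrad E (F (h z)) = cgrad G (F (h z))"
      using hz disc_in [OF hz] W(4) by (intro cgrad_eq_of_eq_on [OF G(1) D(1) E(3,1,4)]) auto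
    then have "cdot (z - f (h z)) (cgrad G (f (h z))) = 0"
      using h0 [of z] z disc_in(2) [OF hz] by (simp add: B_def w_def)
    then show ?thesis
      unfolding lempert_left_inverse_def using hz z
        gradient_zero_unique [OF D assms(5) f, of z _ "h z"]
      by (intro the_equality [symmetric]) (auto simp: B_def)
  qed
  then show ?thesis
    unfolding fun_extends_through_def using r(2) h
    by (intro exI [of _ "ball (F l0) d"] exI [of _ h]) (auto simp: B_def)
qed

end
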